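(* For $n\ge 1$, let $B_n:=|\mathsf{Div}_L(\rho_n^n)|$ be the number of left divisors of $\rho_n^n$ in $M_n$. Then $B_n=F_{2n-1}$ for all $n\ge 1$.
   Context: For $n\ge 1$, let $M_n$ be the monoid with presentation $\langle \rho_1,\dots,\rho_n \mid \rho_1\rho_n\rho_i=\rho_{i+1}\rho_n \text{ for all } 1\le i\le n-1\rangle$. $\mathsf{Div}_L(\rho_n^n)$ is the set of left divisors of $\rho_n^n$, i.e. of $a\in M_n$ such that $ac=\rho_n^n$ for some $c\in M_n$. The Fibonacci sequence is indexed here by $F_0=1$, $F_1=2$, $F_i=F_{i-1}+F_{i-2}$ for $i\ge 2$ (so $1,2,3,5,8,\dots$). *)

theory Defs
  imports "HOL-Algebra.Divisibility" "HOL-Number_Theory.Fib"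
begin

text \<open>The smallest congruence on the free monoid \<^term>\<open>lists S\<close> of words over \<open>S\<close>
  that identifies both sides of every relation in \<open>R\<close>.\<close>

inductive_set pres_cong :: "'a set \<Rightarrow> ('a list \<times> 'a list) set \<Rightarrow> ('a list \<times> 'a list) set"
  for S :: "'a set" and R :: "('a list \<times> 'a list) set"
where
  refl: "w \<in> lists S \<Longrightarrow> (w, w) \<in> pres_cong S R"
| sym: "(v, w) \<in> pres_cong S R \<Longrightarrow> (w, v) \<in> pres_cong S R"
| trans: "(u, v) \<in> pres_cong S R \<Longrightarrow> (v, w) \<in> pres_cong S R \<Longrightarrow> (u, w) \<in> pres_cong S R"
| rel: "(u, v) \<in> R \<Longrightarrow> u \<in> lists S \<Longrightarrow> v \<in> lists S \<Longrightarrow> x \<in> lists S \<Longrightarrow> y \<in> lists S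
    \<Longrightarrow> (x @ u @ y, x @ v @ y) \<in> pres_cong S R"

definition pres_monoid :: "'a set \<Rightarrow> ('a list \<times> 'a list) set \<Rightarrow> 'a list set monoid" where
  "pres_monoid S R =
    \<lparr>carrier = lists S // pres_cong S R,
     mult = (\<lambda>A B. \<Union>a\<in>A. \<Union>b\<in>B. pres_cong S R `` {a @ b}),
     one = pres_cong S R `` {[]}\<rparr>"

definition pres_gen :: "'a set \<Rightarrow> ('a list \<times> 'a list) set \<Rightarrow> 'a \<Rightarrow> 'a list set" where
  "pres_gen S R s = pres_cong S R `` {[s]}"

lemma pres_cong_lists:
  "(v, w) \<in> pres_cong S R \<Longrightarrow> v \<in> lists S \<and> w \<in> lists S"
  by (induction rule: pres_cong.induct) auto

lemma equiv_pres_cong: "equiv (lists S) (pres_cong S R)"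
proof (rule equivI)
  show "pres_cong S R \<subseteq> lists S \<times> lists S"
    using pres_cong_lists by fast
  show "refl_on (lists S) (pres_cong S R)"
    by (rule refl_onI) (rule pres_cong.refl)
  show "Relation.sym (pres_cong S R)"
    by (rule symI) (rule pres_cong.sym)
  show "Relation.trans (pres_cong S R)"
    by (rule transI) (rule pres_cong.trans)
qed

lemma pres_cong_append_left:
  assumes "(v, w) \<in> pres_cong S R" "x \<in> lists S"
  shows "(x @ v, x @ w) \<in> pres_cong S R"
  using assms
proof (induction rule: pres_cong.induct)
  case (rel u v z y)
  then show ?case using pres_cong.rel[of u v R S "x @ z" y] by simp
next
  case (refl w)
  then show ?case by (intro pres_cong.refl) auto
qed (blast intro: pres_cong.sym pres_cong.trans)+

lemma pres_cong_append_right: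
  assumes "(v, w) \<in> pres_cong S R" "y \<in> lists S"
  shows "(v @ y, w @ y) \<in> pres_cong S R"
  using assms
proof (induction rule: pres_cong.induct)
  case (rel u v x z)
  then show ?case using pres_cong.rel[of u v R S x "z @ y"] by simp
next
  case (refl w)
  then show ?case by (intro pres_cong.refl) auto
qed (blast intro: pres_cong.sym pres_cong.trans)+

lemma pres_cong_append:
  assumes "(v, w) \<in> pres_cong S R" "(v', w') \<in> pres_cong S R"
  shows "(v @ v', w @ w') \<in> pres_cong S R"
proof (rule pres_cong.trans)
  show "(v @ v', w @ v') \<in> pres_cong S R"
    using assms pres_cong_lists[OF assms(2)] by (intro pres_cong_append_right) auto
  show "(w @ v', w @ w') \<in> pres_cong S R"
    using assms pres_cong_lists[OF assms(1)] by (intro pres_cong_append_left) auto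
qed

lemma mult_pres_monoid:
  assumes "v \<in> lists S" "w \<in> lists S"
  shows "pres_cong S R `` {v} \<otimes>\<^bsub>pres_monoid S R\<^esub> pres_cong S R `` {w}
    = pres_cong S R `` {v @ w}"
proof -
  have "congruent2 (pres_cong S R) (pres_cong S R) (\<lambda>a b. pres_cong S R `` {a @ b})"
    by (intro congruent2I' equiv_class_eq[OF equiv_pres_cong] pres_cong_append)
  then show ?thesis
    using UN_equiv_class2[OF equiv_pres_cong equiv_pres_cong _ assms]
    by (simp add: pres_monoid_def)
qed

lemma monoid_pres_monoid: "monoid (pres_monoid S R)"
proof -
  have car: "carrier (pres_monoid S R) = (\<lambda>w. pres_cong S R `` {w}) ` lists S"
    by (auto simp: pres_monoid_def quotient_def)
  have one: "\<one>\<^bsub>pres_monoid S R\<^esub> = pres_cong S R `` {[]}"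
    by (simp add: pres_monoid_def)
  show ?thesis
  proof (rule monoidI, unfold car one, goal_cases)
    case (1 x y)
    then obtain a b where ab: "a \<in> lists S" "b \<in> lists S"
      "x = pres_cong S R `` {a}" "y = pres_cong S R `` {b}"
      by blast
    then have "x \<otimes>\<^bsub>pres_monoid S R\<^esub> y = pres_cong S R `` {a @ b}"
      by (simp only: mult_pres_monoid)
    moreover from ab have "a @ b \<in> lists S" by auto
    ultimately show ?case by blast
  next
    case 2
    show ?case by simp
  next
    case (3 x y z)
    then obtain a b c where "a \<in> lists S" "b \<in> lists S" "c \<in> lists S"
      "x = pres_cong S R `` {a}" "y = pres_cong S R `` {b}" "z = pres_cong S R `` {c}"
      by blast
    moreover from this have "a @ b \<in> lists S" "b @ c \<in> lists S" by auto
    ultimately show ?case by (simp add: mult_pres_monoid del: in_lists_conv_set)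
  next
    case (4 x)
    then show ?case using mult_pres_monoid[of "[]" S] by auto
  next
    case (5 x)
    then show ?case using mult_pres_monoid[of _ S "[]"] by auto
  qed
qed

text \<open>The letter \<open>i\<close> of a word stands for the generator \<open>\<rho>\<^sub>i\<close>.\<close>

definition M_rels :: "nat \<Rightarrow> (nat list \<times> nat list) set" where
  "M_rels n = {([1, n, i], [i + 1, n]) | i. 1 \<le> i \<and> i \<le> n - 1}"

definition M :: "nat \<Rightarrow> nat list set monoid" where
  "M n = pres_monoid {1..n} (M_rels n)"

definition \<rho> :: "nat \<Rightarrow> nat \<Rightarrow> nat list set" where
  "\<rho> n i = pres_gen {1..n} (M_rels n) i"

text \<open>In a non-commutative monoid, the library's \<open>a divides b\<close> is left divisibility:
  \<open>b = a \<otimes> c\<close> for some \<open>c\<close>.\<close>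

definition Div_L :: "('a, 'b) monoid_scheme \<Rightarrow> 'a \<Rightarrow> 'a set" where
  "Div_L G x = {a \<in> carrier G. a divides\<^bsub>G\<^esub> x}"

definition B :: "nat \<Rightarrow> nat" where
  "B n = card (Div_L (M n) (\<rho> n n [^]\<^bsub>M n\<^esub> n))"

lemma monoid_M: "monoid (M n)"
  by (simp add: M_def monoid_pres_monoid)

lemma \<rho>_closed: "i \<in> {1..n} \<Longrightarrow> \<rho> n i \<in> carrier (M n)"
  unfolding \<rho>_def M_def pres_gen_def pres_monoid_def by (auto intro: quotientI)

lemma M_relation:
  assumes "1 \<le> i" "i \<le> n - 1"
  shows "\<rho> n 1 \<otimes>\<^bsub>M n\<^esub> \<rho> n n \<otimes>\<^bsub>M n\<^esub> \<rho> n i = \<rho> n (i + 1) \<otimes>\<^bsub>M n\<^esub> \<rho> n n"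
proof -
  have "([1, n, i], [i + 1, n]) \<in> pres_cong {1..n} (M_rels n)"
    using assms pres_cong.rel[of "[1, n, i]" "[i + 1, n]" "M_rels n" "{1..n}" "[]" "[]"]
    by (auto simp: M_rels_def)
  then have "pres_cong {1..n} (M_rels n) `` {[1, n, i]} = pres_cong {1..n} (M_rels n) `` {[i + 1, n]}"
    by (rule equiv_class_eq[OF equiv_pres_cong])
  then show ?thesis
    using assms by (simp add: M_def \<rho>_def pres_gen_def mult_pres_monoid)
qed

text \<open>The Fibonacci sequence indexed as \<open>1, 2, 3, 5, 8, \<dots>\<close>, starting at \<open>F 0\<close>; the library's
  \<^const>\<open>fib\<close> starts with \<open>0, 1, 1, 2\<close>.\<close>

definition F :: "nat \<Rightarrow> nat" where
  "F i = fib (i + 2)"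

lemma F_0: "F 0 = 1"
  by (simp add: F_def numeral_2_eq_2)

lemma F_1: "F 1 = 2"
  by (simp add: F_def numeral_3_eq_3)

lemma F_rec:
  assumes "i \<ge> 2"
  shows "F i = F (i - 1) + F (i - 2)"
proof -
  obtain k where "i = Suc (Suc k)"
    using assms by (metis Suc_le_D numeral_2_eq_2 Suc_le_mono)
  then show ?thesis
    by (simp add: F_def)
qed

end

theory Submission
  imports Defs
begin

text \<open>Put \<open>x = \<rho>\<^sub>1\<rho>\<^sub>n\<close> and \<open>y = \<rho>\<^sub>n\<close>. The relations say that \<open>\<rho>\<^sub>k y\<^sup>k = x\<^sup>k\<close>, so \<open>\<rho>\<^sub>k\<close> behaves like
  \<open>x\<^sup>k y\<^sup>-\<^sup>k\<close>, with \<open>x\<^sup>n = y\<^sup>n\<^sup>+\<^sup>1\<close>. For \<open>m \<le> n\<close> the left divisors of \<open>y\<^sup>m\<close> are the elements that can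
  be written as \<open>y\<close> to the \<open>m - b\<^sub>0\<close>, followed by \<open>x\<close> to the \<open>k\<^sub>i\<close> and \<open>y\<close> to the \<open>-b\<^sub>i\<close> for
  \<open>i = 1, \<dots>, r\<close>, where \<open>m \<ge> b\<^sub>0 > k\<^sub>1 \<ge> b\<^sub>1 > k\<^sub>2 \<ge> b\<^sub>2 > \<dots> > k\<^sub>r \<ge> b\<^sub>r \<ge> 0\<close> and all \<open>k\<^sub>i > 0\<close>. Such a
  chain is encoded, last entries first, by the pair of \<open>b\<^sub>r\<close> and the list of the
  \<open>(k\<^sub>i, b\<^sub>i\<^sub>-\<^sub>1)\<close> for \<open>i = r, \<dots>, 1\<close>. Right multiplication by generators is a partial action of
  \<open>M\<^sub>n\<close> on the chains, undefined where the product no longer divides \<open>y\<^sup>m\<close>; it separates the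
  divisors, and the chains are counted by a Fibonacci recursion.\<close>

fun chain :: "nat \<Rightarrow> nat \<Rightarrow> (nat \<times> nat) list \<Rightarrow> bool" where
  "chain m b [] \<longleftrightarrow> b \<le> m"
| "chain m b ((k, b') # s) \<longleftrightarrow> b \<le> k \<and> 0 < k \<and> k < b' \<and> chain m b' s"

lemma chain_antimono: "chain m b s \<Longrightarrow> c \<le> b \<Longrightarrow> chain m c s"
  by (cases s) auto

lemma chain_le: "chain m b s \<Longrightarrow> b \<le> m"
  by (induction m b s rule: chain.induct) auto

section \<open>Counting chains\<close>

lemma chains_top: "{s. chain m m s} = {[]}"
proof -
  have "s = []" if "chain m m s" for s
    using that chain_le by (cases s) fastforce+
  then show ?thesis by auto
qed

text \<open>Case split on the exponent \<open>k\<close> at the head: either it equals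
  \<open>b\<close>, or the list still meets the stricter bound \<open>Suc b\<close>. Since
  \<open>b < m\<close>, the empty list falls under the second case.\<close>

lemma chains_Suc:
  assumes "0 < b" "b < m"
  shows "{s. chain m b s} =
    {s. chain m (Suc b) s} \<union> (\<lambda>(b', s). (b, b') # s) ` (SIGMA b':{b<..m}. {s. chain m b' s})"
    (is "_ = ?A \<union> ?B")
proof (intro equalityI subsetI)
  fix s assume "s \<in> {s. chain m b s}"
  then have s: "chain m b s" by simp
  show "s \<in> ?A \<union> ?B"
  proof (cases s)
    case Nil
    then show ?thesis using assms by simp
  next
    case (Cons p t)
    obtain k b' where p: "p = (k, b')" by fastforce
    have c: "b \<le> k" "0 < k" "k < b'" "chain m b' t" using s Cons p by auto
    show ?thesis
    proof (cases "k = b")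
      case True
      then have "(b', t) \<in> (SIGMA b':{b<..m}. {s. chain m b' s})" using c chain_le by auto
      then have "(\<lambda>(b', s). (b, b') # s) (b', t) \<in> ?B" by (rule imageI)
      then show ?thesis using True Cons p by simp
    next
      case False
      then show ?thesis using c Cons p by simp
    qed
  qed
next
  fix s assume "s \<in> ?A \<union> ?B"
  then show "s \<in> {s. chain m b s}" using assms by (auto intro: chain_antimono)
qed

text \<open>The sum is carried along so that the induction closes: each step adds the old count to
  the sum and then the new sum to the count, which is two Fibonacci steps.\<close>

lemma chains_card:
  assumes "j < m"
  shows "finite {s. chain m (m - j) s} \<and> card {s. chain m (m - j) s} = fib (2 * j + 1)
    \<and> (\<Sum>b\<in>{m - j<..m}. card {s. chain m b s}) = fib (2 * j)
    \<and> (\<forall>b\<in>{m - j<..m}. finite {s. chain m b s})"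
  using assms
proof (induction j)
  case 0
  then show ?case by (simp add: chains_top)
next
  case (Suc j)
  define b where "b = m - Suc j"
  have b: "0 < b" "b < m" and mj: "m - j = Suc b" using Suc.prems by (auto simp: b_def)
  let ?S = "SIGMA b':{b<..m}. {s. chain m b' s}"
  note IH = Suc.IH[unfolded mj]
  have split: "{b<..m} = insert (Suc b) {Suc b<..m}" using b by auto
  have fin: "\<forall>c\<in>{b<..m}. finite {s. chain m c s}" using IH Suc.prems split by auto
  have sum: "(\<Sum>c\<in>{b<..m}. card {s. chain m c s}) = fib (2 * Suc j)"
    using IH Suc.prems by (simp add: split)
  have inj: "inj_on (\<lambda>(b', s). (b, b') # s) ?S"
    by (auto simp: inj_on_def)
  have finS: "finite ?S" using fin by (intro finite_SigmaI) auto
  have "card ((\<lambda>(b', s). (b, b') # s) ` ?S) = fib (2 * Suc j)"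
    using card_image[OF inj] fin sum by (simp add: card_SigmaI)
  moreover have "{s. chain m (Suc b) s} \<inter> (\<lambda>(b', s). (b, b') # s) ` ?S = {}"
    by auto
  ultimately have "card {s. chain m b s} = fib (2 * Suc j + 1)"
    using IH Suc.prems finS by (simp add: chains_Suc[OF b] card_Un_disjoint)
  moreover have "finite {s. chain m b s}"
    using IH Suc.prems finS by (simp add: chains_Suc[OF b])
  ultimately show ?case
    using fin sum by (simp add: b_def)
qed

lemma card_chains: "card (SIGMA b:{..m}. {s. chain m b s}) = fib (2 * m + 1)"
proof (cases "m = 0")
  case True
  then show ?thesis using chains_top[of 0] by (simp add: card_SigmaI)
next
  case False
  \<comment> \<open>Exponents at the head are positive anyway, so the bounds 0 and 1 admit the same
    lists; this count enters the total twice.\<close>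
  have "{s. chain m 0 s} = {s. chain m (Suc 0) s}"
  proof (intro Collect_cong)
    fix s
    show "chain m 0 s = chain m (Suc 0) s" using False by (cases s) auto
  qed
  then have zero: "finite {s. chain m 0 s}" "card {s. chain m 0 s} = fib (2 * m - 1)"
    and sum: "(\<Sum>b\<in>{Suc 0<..m}. card {s. chain m b s}) = fib (2 * (m - 1))"
    and one: "{s. chain m (Suc 0) s} = {s. chain m 0 s}"
    and fin: "\<forall>b\<in>{Suc 0<..m}. finite {s. chain m b s}"
    using chains_card[of "m - 1" m] False by (auto simp: diff_mult_distrib2 Suc_diff_Suc numeral_2_eq_2)
  have split: "{..m} = insert 0 (insert (Suc 0) {Suc 0<..m})" using False by auto
  obtain l where l: "m = Suc l" using False by (cases m) auto
  have "\<forall>b\<in>{..m}. finite {s. chain m b s}" using zero one fin split by auto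
  then have "card (SIGMA b:{..m}. {s. chain m b s}) = (\<Sum>b\<le>m. card {s. chain m b s})"
    by (simp add: card_SigmaI)
  also have "\<dots> = fib (2 * m - 1) + (fib (2 * m - 1) + fib (2 * (m - 1)))"
    using zero sum one by (simp add: split)
  also have "\<dots> = fib (2 * m + 1)" by (simp add: l)
  finally show ?thesis .
qed

section \<open>The partial right action\<close>

text \<open>In the last case \<open>x\<^sup>k \<rho>\<^sub>j = x\<^sup>n y\<^sup>-\<^sup>j\<close>, and \<open>x\<^sup>n = y\<^sup>n\<^sup>+\<^sup>1\<close> turns this into \<open>y\<^sup>k\<^sup>+\<^sup>1\<close>, which cancels
  against the preceding power of \<open>y\<close>, whose exponent is \<open>-b'\<close>.\<close>

fun step :: "nat \<Rightarrow> nat \<Rightarrow> nat \<times> (nat \<times> nat) list \<Rightarrow> (nat \<times> (nat \<times> nat) list) option" where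
  "step n j (Suc b, s) =
    (if j = n then Some (b, s) else if j \<le> b then Some (j, (j, Suc b) # s) else None)"
| "step n j (0, []) = None"
| "step n j (0, (k, b') # s) =
    (if k + j < b' then Some (j, (k + j, b') # s)
     else if k + j = n then Some (b' - Suc k, s) else None)"

primrec run :: "nat \<Rightarrow> nat list \<Rightarrow> nat \<times> (nat \<times> nat) list \<Rightarrow> (nat \<times> (nat \<times> nat) list) option" where
  "run n [] p = Some p"
| "run n (j # w) p = Option.bind (step n j p) (run n w)"

lemma run_append: "run n (u @ v) p = Option.bind (run n u p) (run n v)"
proof (induction u arbitrary: p)
  case (Cons j u)
  then show ?case by (cases "step n j p") auto
qed simp

lemma step_chain:
  assumes "m \<le> n" "0 < j" "case_prod (chain m) p" "step n j p = Some q"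
  shows "case_prod (chain m) q"
  using assms
  by (induction n j p rule: step.induct) (auto split: if_splits intro: chain_antimono)

lemma run_chain:
  assumes mn: "m \<le> n" and "w \<in> lists {1..n}" "case_prod (chain m) p" "run n w p = Some q"
  shows "case_prod (chain m) q"
  using assms(2-)
proof (induction w arbitrary: p rule: list.induct)
  case (Cons j w)
  then obtain p' where p': "step n j p = Some p'" "run n w p' = Some q"
    by (auto simp: bind_eq_Some_conv)
  moreover have "case_prod (chain m) p'"
    using step_chain[OF mn _ _ p'(1)] Cons.prems(1,2) by simp
  ultimately show ?case using Cons by auto
qed simp

lemma run_relation:
  assumes "m \<le> n" "case_prod (chain m) p" "1 \<le> i" "i \<le> n - 1"
  shows "run n [1, n, i] p = run n [i + 1, n] p"
proof -
  obtain b s where p: "p = (b, s)" by fastforce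
  have b: "chain m b s" "b \<le> m" using assms(2) p chain_le by auto
  show ?thesis
  proof (cases b)
    case 0
    show ?thesis
    proof (cases s)
      case Nil
      then show ?thesis using 0 p by simp
    next
      case (Cons a t)
      obtain k b' where a: "a = (k, b')" by fastforce
      have k: "0 < k" "k < b'" "chain m b' t" "b' \<le> m" using b Cons a chain_le by auto
      \<comment> \<open>At 0 the letter \<open>n\<close> never acts: \<open>k > 0\<close> and
        \<open>b' \<le> m \<le> n\<close> exclude both branches of \<open>step\<close>. So if
        \<open>b' = Suc k\<close>, both sides of the relation are undefined.\<close>
      have stuck: "step n n (0, t) = None"
      proof (cases t)
        case (Cons c t')
        then show ?thesis using k \<open>m \<le> n\<close> chain_le by (cases c) fastforce
      qed simp
      show ?thesis
      proof (cases "Suc k < b'")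
        case True
        obtain d where "b' = Suc (Suc (k + d))"
          using True by (metis less_iff_Suc_add add_Suc)
        then show ?thesis using assms k 0 Cons a p by auto
      next
        case False
        then have "b' = Suc k" using k by simp
        then show ?thesis using assms k 0 Cons a p stuck by auto
      qed
    qed
  next
    case (Suc c)
    have stuck: "step n n (0, s) = None"
    proof (cases s)
      case (Cons a t)
      then show ?thesis using b \<open>m \<le> n\<close> chain_le by (cases a) fastforce
    qed simp
    then show ?thesis using assms b p Suc by (cases c) auto
  qed
qed

text \<open>The action descends to \<open>M n\<close>, so the chain reached from
  \<open>(m, [])\<close> is an invariant of the element.\<close>

lemma run_cong:
  assumes "(v, w) \<in> pres_cong {1..n} (M_rels n)" "m \<le> n" "case_prod (chain m) p"
  shows "run n v p = run n w p"
  using assms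
proof (induction arbitrary: p rule: pres_cong.induct)
  case (rel u v x y)
  then obtain i where i: "u = [1, n, i]" "v = [i + 1, n]" "1 \<le> i" "i \<le> n - 1"
    by (auto simp: M_rels_def)
  show ?case
  proof (cases "run n x p")
    case (Some q)
    then have "case_prod (chain m) q" using run_chain rel by blast
    then have "run n u q = run n v q" using run_relation i rel.prems(1) by blast
    then show ?thesis using Some by (simp add: run_append)
  qed (simp add: run_append)
qed simp_all

section \<open>Canonical words\<close>

text \<open>Since \<open>\<rho>\<^sub>k y\<^sup>k = x\<^sup>k\<close>, the factor
  \<open>x^k y^(-b)\<close> is spelled without inverses as the letter \<open>k\<close> followed by
  \<open>k - b\<close> letters \<open>n\<close>; this is why chains require
  \<open>b \<le> k\<close>.\<close>

fun canon :: "nat \<Rightarrow> nat \<Rightarrow> nat \<Rightarrow> (nat \<times> nat) list \<Rightarrow> nat list" where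
  "canon n m b [] = replicate (m - b) n"
| "canon n m b ((k, b') # s) = canon n m b' s @ k # replicate (k - b) n"

lemma canon_lists: "m \<le> n \<Longrightarrow> chain m b s \<Longrightarrow> canon n m b s \<in> lists {1..n}"
proof (induction n m b s rule: canon.induct)
  case (2 n m b k b' s)
  then have "b' \<le> m" using chain_le by auto
  then show ?case using 2 by auto
qed auto

lemma canon_snoc:
  assumes "chain m b s" "c \<le> b"
  shows "canon n m b s @ replicate c n = canon n m (b - c) s"
proof (cases s)
  case Nil
  then have "m - (b - c) = (m - b) + c" using assms by simp
  then show ?thesis using Nil by (simp add: replicate_add)
next
  case (Cons a t)
  obtain k b' where a: "a = (k, b')" by fastforce
  have "k - (b - c) = (k - b) + c" using assms Cons a by simp
  then show ?thesis using Cons a by (simp add: replicate_add)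
qed

lemma run_replicate: "c \<le> b \<Longrightarrow> run n (replicate c n) (b, s) = Some (b - c, s)"
proof (induction c arbitrary: b)
  case (Suc c)
  then obtain d where "b = Suc d" by (cases b) auto
  then show ?case using Suc by simp
qed simp

text \<open>The chain is recovered from its word, so by \<open>run_cong\<close> different chains
  give incongruent words.\<close>

lemma run_canon: "m \<le> n \<Longrightarrow> chain m b s \<Longrightarrow> run n (canon n m b s) (m, []) = Some (b, s)"
proof (induction n m b s rule: canon.induct)
  case (1 n m b)
  then show ?case by (simp add: run_replicate)
next
  case (2 n m b k b' s)
  then have "b' \<le> m" using chain_le by auto
  obtain d where "b' = Suc d" using 2 by (cases b') auto
  then show ?case using 2 \<open>b' \<le> m\<close> by (auto simp: run_append run_replicate)
qed

text \<open>The chain \<open>(0, [])\<close> stands for \<open>y^m\<close>, so this produces the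
  complementary factor of a divisor.\<close>

lemma reach_zero:
  assumes "m \<le> n" "chain m b s"
  shows "\<exists>c\<in>lists {1..n}. run n c (b, s) = Some (0, [])"
  using assms(2)
proof (induction s arbitrary: b)
  case Nil
  then have "replicate b n \<in> lists {1..n}" using assms(1) by auto
  then show ?case using run_replicate[of b b n "[]"] by auto
next
  case (Cons a t)
  obtain k b' where a: "a = (k, b')" by fastforce
  have k: "b \<le> k" "0 < k" "k < b'" "chain m b' t" "b' \<le> m" using Cons.prems a chain_le by auto
  then obtain c where c: "c \<in> lists {1..n}" "run n c (b' - Suc k, t) = Some (0, [])"
    using Cons.IH chain_antimono by (metis diff_le_self)
  \<comment> \<open>The letters \<open>n\<close> lower \<open>b\<close> to 0. Then
    \<open>n - k\<close> triggers the last case of \<open>step\<close>, as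
    \<open>k + (n - k) = n \<ge> b'\<close>, and removes the head.\<close>
  have "run n (replicate b n @ (n - k) # c) (b, a # t) = Some (0, [])"
    using k c a assms(1) by (simp add: run_append run_replicate)
  moreover have "replicate b n @ (n - k) # c \<in> lists {1..n}"
    using k c assms(1) by auto
  ultimately show ?case by blast
qed

abbreviation word_cong :: "nat \<Rightarrow> nat list \<Rightarrow> nat list \<Rightarrow> bool" where
  "word_cong n v w \<equiv> (v, w) \<in> pres_cong {1..n} (M_rels n)"

text \<open>Since \<open>\<rho>\<^sub>k y\<^sup>k = x\<^sup>k\<close>, this is \<open>x\<^sup>k \<rho>\<^sub>j = \<rho>\<^sub>k\<^sub>+\<^sub>j y\<^sup>k\<close>, the \<open>k\<close>-fold iterate of the relations.\<close>

lemma power_relation: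
  assumes "1 \<le> k" "1 \<le> j" "k + j \<le> n"
  shows "word_cong n (k # replicate k n @ [j]) ((k + j) # replicate k n)"
  using assms
proof (induction k rule: dec_induct)
  case base
  have "word_cong n ([] @ [1, n, j] @ []) ([] @ [j + 1, n] @ [])"
    using base by (intro pres_cong.rel) (auto simp: M_rels_def)
  then show ?case by simp
next
  case (step k)
  have IH: "word_cong n (k # replicate k n @ [j]) ((k + j) # replicate k n)"
    using step by simp
  have "word_cong n ([] @ [k + 1, n] @ (replicate k n @ [j])) ([] @ [1, n, k] @ (replicate k n @ [j]))"
    using step by (intro pres_cong.sym[OF pres_cong.rel]) (auto simp: M_rels_def)
  moreover have "word_cong n ([1, n] @ k # replicate k n @ [j]) ([1, n] @ (k + j) # replicate k n)"
    using step by (intro pres_cong_append_left[OF IH]) auto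
  moreover have "word_cong n ([] @ [1, n, k + j] @ replicate k n) ([] @ [k + j + 1, n] @ replicate k n)"
    using step by (intro pres_cong.rel) (auto simp: M_rels_def)
  ultimately have "word_cong n ([] @ [k + 1, n] @ (replicate k n @ [j])) ([] @ [k + j + 1, n] @ replicate k n)"
    by (simp del: replicate_Suc) (meson pres_cong.trans)
  then show ?case by simp
qed

lemma canon_step:
  assumes "m \<le> n" "chain m b s" "j \<in> {1..n}" "step n j (b, s) = Some (c, t)"
  shows "word_cong n (canon n m b s @ [j]) (canon n m c t)"
proof (cases b)
  case (Suc d)
  have "canon n m b s @ [j] = canon n m c t"
  proof (cases "j = n")
    case True
    then show ?thesis using assms Suc canon_snoc[of m b s 1 n] by simp
  next
    case False
    then show ?thesis using assms Suc by (auto split: if_splits)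
  qed
  moreover have "canon n m b s @ [j] \<in> lists {1..n}"
    using canon_lists assms by auto
  ultimately show ?thesis by (metis pres_cong.refl)
next
  case 0
  then obtain k b' r where s: "s = (k, b') # r" using assms by (cases s) auto
  have k: "0 < k" "k < b'" "chain m b' r" "b' \<le> m" using assms s chain_le by auto
  have "k + j \<le> n" using assms k s 0 by (auto split: if_splits)
  then have cong: "word_cong n (canon n m b' r @ k # replicate k n @ [j])
      (canon n m b' r @ (k + j) # replicate k n)"
    using k assms by (intro pres_cong_append_left power_relation canon_lists) auto
  show ?thesis
  proof (cases "k + j < b'")
    case True
    then have "c = j" "t = (k + j, b') # r" using assms s 0 by auto
    then show ?thesis using cong s 0 by simp
  next
    case False
    then have kj: "k + j = n" and ct: "c = b' - Suc k" "t = r"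
      using assms s 0 by (auto split: if_splits)
    \<comment> \<open>With \<open>k + j = n\<close> the appended word is \<open>y^(k+1)\<close>,
      which is absorbed because \<open>Suc k \<le> b'\<close>.\<close>
    have "canon n m b' r @ (k + j) # replicate k n = canon n m c t"
      using canon_snoc[of m b' r "Suc k" n] k kj ct by simp
    then show ?thesis using cong s 0 by simp
  qed
qed

text \<open>Converse to \<open>run_cong\<close> where the action is defined: the chain reached
  determines the element. No cancellation in \<open>M n\<close> is needed.\<close>

lemma cong_canon:
  assumes "m \<le> n" "w \<in> lists {1..n}" "run n w (m, []) = Some (b, s)"
  shows "word_cong n w (canon n m b s)"
  using assms(2-)
proof (induction w arbitrary: b s rule: rev_induct)
  case Nil
  then show ?case by (auto intro: pres_cong.refl)
next
  case (snoc j w)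
  then obtain c t where ct: "run n w (m, []) = Some (c, t)" "step n j (c, t) = Some (b, s)"
    by (auto simp: run_append bind_eq_Some_conv)
  have w: "w \<in> lists {1..n}" and j: "j \<in> {1..n}" using snoc.prems by auto
  have "chain m c t" using run_chain[OF assms(1) w _ ct(1)] by simp
  then have "word_cong n (canon n m c t @ [j]) (canon n m b s)"
    using canon_step assms(1) j ct(2) by blast
  moreover have "word_cong n (w @ [j]) (canon n m c t @ [j])"
    using j by (intro pres_cong_append_right snoc.IH w ct(1)) auto
  ultimately show ?case by (rule pres_cong.trans[rotated])
qed

section \<open>Divisors\<close>

lemma \<rho>_pow:
  assumes "1 \<le> n"
  shows "\<rho> n n [^]\<^bsub>M n\<^esub> m = pres_cong {1..n} (M_rels n) `` {replicate m n}"
proof (induction m)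
  case 0
  then show ?case by (simp add: M_def pres_monoid_def nat_pow_def)
next
  case (Suc m)
  have "replicate m n @ [n] = n # replicate m n" "replicate m n \<in> lists {1..n}"
    using assms by (auto simp: replicate_append_same)
  then show ?case
    using Suc mult_pres_monoid[of "replicate m n" "{1..n}" "[n]" "M_rels n"] assms
    by (simp add: M_def \<rho>_def pres_gen_def nat_pow_def del: in_lists_conv_set)
qed

lemma Div_L_pow:
  assumes "1 \<le> n" "m \<le> n"
  shows "Div_L (M n) (\<rho> n n [^]\<^bsub>M n\<^esub> m) =
    (\<lambda>(b, s). pres_cong {1..n} (M_rels n) `` {canon n m b s}) ` (SIGMA b:{..m}. {s. chain m b s})"
    (is "?D = ?f ` ?C")
proof (intro equalityI subsetI)
  let ?K = "pres_cong {1..n} (M_rels n)"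
  have carrier: "carrier (M n) = (\<lambda>w. ?K `` {w}) ` lists {1..n}"
    by (auto simp: M_def pres_monoid_def quotient_def)
  have pow: "run n (replicate m n) (m, []) = Some (0, [])"
    using run_replicate[of m m] by simp
  {
    fix a assume "a \<in> ?D"
    then obtain u v where u: "u \<in> lists {1..n}" "a = ?K `` {u}" and v: "v \<in> lists {1..n}"
      and "?K `` {replicate m n} = ?K `` {u} \<otimes>\<^bsub>M n\<^esub> ?K `` {v}"
      unfolding Div_L_def factor_def carrier \<rho>_pow[OF assms(1)] by blast
    then have "?K `` {replicate m n} = ?K `` {u @ v}"
      by (simp add: M_def mult_pres_monoid del: in_lists_conv_set)
    then have "word_cong n (replicate m n) (u @ v)"
      by (rule eq_equiv_class[OF _ equiv_pres_cong]) (use u v in auto)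
    then have "run n (u @ v) (m, []) = Some (0, [])"
      using run_cong[OF _ assms(2), of "replicate m n" "u @ v" "(m, [])"] pow by simp
    \<comment> \<open>A prefix of a word with a defined run has a defined run; this is how
      divisibility forces a chain.\<close>
    then obtain b s where bs: "run n u (m, []) = Some (b, s)"
      by (auto simp: run_append bind_eq_Some_conv)
    have "chain m b s" using run_chain[OF assms(2) u(1) _ bs] by simp
    then have "(b, s) \<in> ?C" using chain_le by auto
    moreover have "a = ?f (b, s)"
      using equiv_class_eq[OF equiv_pres_cong cong_canon[OF assms(2) u(1) bs]] u by simp
    ultimately show "a \<in> ?f ` ?C" by (rule rev_image_eqI)
  next
    fix a assume "a \<in> ?f ` ?C"
    then obtain b s where bs: "chain m b s" and a: "a = ?K `` {canon n m b s}" by auto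
    obtain c where c: "c \<in> lists {1..n}" "run n c (b, s) = Some (0, [])"
      using reach_zero[OF assms(2) bs] by blast
    have l: "canon n m b s \<in> lists {1..n}" using canon_lists[OF assms(2) bs] .
    have "run n (canon n m b s @ c) (m, []) = Some (0, [])"
      using run_canon[OF assms(2) bs] c by (simp add: run_append)
    then have "word_cong n (canon n m b s @ c) (canon n m 0 [])"
      using l c by (intro cong_canon assms) auto
    then have "word_cong n (canon n m b s @ c) (replicate m n)" by simp
    then have "?K `` {replicate m n} = a \<otimes>\<^bsub>M n\<^esub> ?K `` {c}"
      using equiv_class_eq[OF equiv_pres_cong, of "canon n m b s @ c" "replicate m n"] l c a
      by (simp add: M_def mult_pres_monoid del: in_lists_conv_set)
    then show "a \<in> ?D"
      unfolding Div_L_def factor_def carrier \<rho>_pow[OF assms(1)] using l c a by blast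
  }
qed

theorem card_Div_L_pow:
  assumes "1 \<le> n" "m \<le> n"
  shows "card (Div_L (M n) (\<rho> n n [^]\<^bsub>M n\<^esub> m)) = fib (2 * m + 1)"
proof -
  let ?f = "\<lambda>(b, s). pres_cong {1..n} (M_rels n) `` {canon n m b s}"
  let ?C = "SIGMA b:{..m}. {s. chain m b s}"
  have "inj_on ?f ?C"
  proof (intro inj_onI)
    fix p q assume "p \<in> ?C" "q \<in> ?C" "?f p = ?f q"
    then obtain b s c t where pq: "p = (b, s)" "q = (c, t)" and ch: "chain m b s" "chain m c t"
      and eq: "pres_cong {1..n} (M_rels n) `` {canon n m b s}
        = pres_cong {1..n} (M_rels n) `` {canon n m c t}"
      by auto
    have "word_cong n (canon n m b s) (canon n m c t)"
      using eq_equiv_class[OF eq equiv_pres_cong canon_lists[OF assms(2) ch(2)]] .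
    then have "run n (canon n m b s) (m, []) = run n (canon n m c t) (m, [])"
      by (rule run_cong[OF _ assms(2)]) simp
    then show "p = q" using run_canon[OF assms(2)] ch pq by simp
  qed
  then show ?thesis
    using card_image[of ?f ?C] card_chains[of m] by (simp only: Div_L_pow[OF assms])
qed

theorem lemma4p3:
  fixes n :: nat
  assumes "n \<ge> 1"
  shows "B n = F (2 * n - 1)"
  using card_Div_L_pow[OF assms order_refl] assms by (simp add: B_def F_def)

end
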